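(* Let $(S,\cdot)$ be a semigroup which satisfies the Strong F\o lner Condition. Then for every subset $A$ of $S$, $d(A)=d^*(A)=d_t(A)$.
   Context: For a semigroup $S$ and $x\in S$, $\lambda_x(y)=xy$; for $A\subseteq S$, $x^{-1}A=\{y\in S:xy\in A\}$ and $Ax^{-1}=\{y\in S:yx\in A\}$. ${\mathcal P}_f(S)$ is the set of finite nonempty subsets of $S$. $l_\infty(S)$ is the space of bounded real functions on $S$ with the sup norm. A mean on $S$ is a continuous linear functional $\mu$ on $l_\infty(S)$ with $\|\mu\|=1$ and $\mu(g)\ge 0$ whenever $g\ge 0$; it is left invariant if $\mu(g\circ\lambda_s)=\mu(g)$ for all $s\in S$, $g\in l_\infty(S)$. $LIM(S)$ is the set of left invariant means; $S$ is left amenable if $LIM(S)\neq\emptyset$. For a mean $\mu$ and $A\subseteq S$, $\mu(A)$ means $\mu(\chi_A)$. $S$ satisfies the Strong F\o lner Condition (SFC) if for every $H\in{\mathcal P}_f(S)$ and $\epsilon>0$ there is $K\in{\mathcal P}_f(S)$ with $|K\setminus sK|<\epsilon|K|$ for all $s\in H$ (SFC implies left amenability). Densities: for $S$ satisfying SFC, the F\o lner density $d(A)$ is the supremum of $\alpha\in[0,1]$ such that for every $H\in{\mathcal P}_f(S)$ and $\epsilon>0$ there is $K\in{\mathcal P}_f(S)$ with $|K\setminus sK|<\epsilon|K|$ for all $s\in H$ and $|A\cap K|\ge\alpha|K|$. For left amenable $S$, the Banach density is $d^*(A)=\sup\{\lambda(\chi_A):\lambda\in LIM(S)\}$. For any semigroup,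 the translation density is $d_t(A)=\sup\{\alpha\in[0,1]:$ for every $F\in{\mathcal P}_f(S)$ there is $s\in S$ with $|F\cap As^{-1}|\ge\alpha|F|\}$. *)

theory Defs
  imports "HOL-Analysis.Analysis" "HOL-Probability.Discrete_Topology"
begin

definition finite_nonempty :: "'a set set" where
  "finite_nonempty = {F. finite F \<and> F \<noteq> {}}"

text \<open>
  The Banach space of bounded real functions on the semigroup, with the sup norm: over the
  discrete topology every function is continuous.
\<close>
type_synonym 'a l_infinity = "'a discrete \<Rightarrow>\<^sub>C real"

lemma discrete_bounded_in_bcontfun:
  fixes f :: "'a discrete \<Rightarrow> real"
  assumes "bounded (range f)"
  shows "f \<in> bcontfun"
  using assms by (simp add: bcontfun_def continuous_on_open_vimage open_discrete)

definition char_fun :: "'a set \<Rightarrow> 'a l_infinity" where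
  "char_fun A = Bcontfun (\<lambda>x. indicator A (of_discrete x))"

lemma apply_char_fun [simp]:
  "apply_bcontfun (char_fun A) x = indicator A (of_discrete x)"
proof -
  have "(\<lambda>x. indicator A (of_discrete x) :: real) \<in> bcontfun"
    by (intro discrete_bounded_in_bcontfun boundedI[where B = 1]) (auto simp: indicator_def)
  then show ?thesis
    by (simp add: char_fun_def Bcontfun_inverse)
qed

definition left_translate :: "'a::semigroup_mult \<Rightarrow> 'a l_infinity \<Rightarrow> 'a l_infinity" where
  "left_translate s g = Bcontfun (\<lambda>x. apply_bcontfun g (discrete (s * of_discrete x)))"

lemma apply_left_translate [simp]:
  "apply_bcontfun (left_translate s g) x = apply_bcontfun g (discrete (s * of_discrete x))"
proof -
  have "(\<lambda>x. apply_bcontfun g (discrete (s * of_discrete x))) \<in> bcontfun"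
    by (intro discrete_bounded_in_bcontfun bounded_subset[OF bounded_apply_bcontfun[of g]]) auto
  then show ?thesis
    by (simp add: left_translate_def Bcontfun_inverse)
qed

definition is_mean :: "('a l_infinity \<Rightarrow>\<^sub>L real) \<Rightarrow> bool" where
  "is_mean \<mu> \<longleftrightarrow>
     norm \<mu> = 1 \<and>
     (\<forall>g. (\<forall>x. 0 \<le> apply_bcontfun g x) \<longrightarrow> 0 \<le> blinfun_apply \<mu> g)"

definition LIM_set :: "('a::semigroup_mult l_infinity \<Rightarrow>\<^sub>L real) set" where
  "LIM_set = {\<mu>. is_mean \<mu> \<and>
     (\<forall>s g. blinfun_apply \<mu> (left_translate s g) = blinfun_apply \<mu> g)}"

text \<open>
  The multiplication need not be cancellative, so the image \<open>s K\<close> may be smaller than \<open>K\<close>.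
\<close>
definition folner_invariant :: "'a::semigroup_mult set \<Rightarrow> real \<Rightarrow> 'a set \<Rightarrow> bool" where
  "folner_invariant H \<epsilon> K \<longleftrightarrow>
     (\<forall>s\<in>H. real (card (K - (\<lambda>y. s * y) ` K)) < \<epsilon> * real (card K))"

definition strong_folner_condition :: "'a::semigroup_mult itself \<Rightarrow> bool" where
  "strong_folner_condition _ \<longleftrightarrow>
     (\<forall>H \<in> (finite_nonempty :: 'a set set). \<forall>\<epsilon>>0. \<exists>K \<in> finite_nonempty.
        folner_invariant H \<epsilon> K)"

definition folner_density :: "'a::semigroup_mult set \<Rightarrow> real" where
  "folner_density A = Sup {\<alpha> \<in> {0..1}.
     \<forall>H \<in> finite_nonempty. \<forall>\<epsilon>>0. \<exists>K \<in> finite_nonempty.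
       folner_invariant H \<epsilon> K \<and> real (card (A \<inter> K)) \<ge> \<alpha> * real (card K)}"

text \<open>
  The value is meaningful only for left amenable semigroups, i.e. when the set of left invariant
  means is nonempty; the strong Folner condition ensures this.
\<close>
definition banach_density :: "'a::semigroup_mult set \<Rightarrow> real" where
  "banach_density A = Sup {blinfun_apply \<mu> (char_fun A) | \<mu>. \<mu> \<in> LIM_set}"

definition right_quotient :: "'a::semigroup_mult set \<Rightarrow> 'a \<Rightarrow> 'a set" where
  "right_quotient A x = {y. y * x \<in> A}"

definition translation_density :: "'a::semigroup_mult set \<Rightarrow> real" where
  "translation_density A = Sup {\<alpha> \<in> {0..1}.
     \<forall>F \<in> finite_nonempty. \<exists>s.
       real (card (F \<inter> right_quotient A s)) \<ge> \<alpha> * real (card F)}"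

end

theory Submission
  imports Defs
begin

text \<open>
  Averages over the right translates \<open>K s\<close> of ever more invariant finite sets \<open>K\<close> accumulate, by
  compactness, at left invariant means; this bounds the Folner density and the translation density
  by the Banach density. Conversely, for a left invariant mean \<open>\<mu>\<close> and a finite set \<open>F\<close>, the function
  \<open>s \<mapsto> |F \<inter> A s\<^sup>-\<^sup>1|\<close> has mean \<open>\<mu>(A) |F|\<close> and finitely many values, so it is at least \<open>\<mu>(A) |F|\<close>
  somewhere.

  For the Folner density, \<open>s\<close> has to be chosen such that \<open>K s\<close> is also almost invariant. The
  strong Folner condition implies that \<open>h x = h y\<close> forces \<open>x r = y r\<close> for some \<open>r\<close>; hence \<open>s\<close> can be
  taken in a right ideal on which \<open>h k s = h k' s\<close> implies \<open>k s = k' s\<close> for the finitely many \<open>h\<close>,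
  \<open>k\<close>, \<open>k'\<close> in question. Since \<open>k \<mapsto> k s\<close> need not be injective, \<open>K s\<close> carries multiplicities; it is
  split into the level sets of the multiplicity, one of which is almost invariant and has almost the
  right density in \<open>A\<close>.
\<close>

lemma in_finite_nonempty_iff: "F \<in> finite_nonempty \<longleftrightarrow> finite F \<and> F \<noteq> {}"
  by (simp add: finite_nonempty_def)

section \<open>Almost invariant finite sets\<close>

text \<open>\<open>U\<close> picks one preimage in \<open>K\<close> for each point of
  \<open>K\<close> that \<open>f\<close> hits. Since \<open>f\<close> is injective on
  \<open>U\<close>, the part of \<open>K\<close> outside \<open>U\<close> is exactly as large as the
  part that \<open>f\<close> misses. This replaces cancellation when \<open>f\<close> is a left
  translation.\<close>

lemma near_injective_subset:
  fixes f :: "'a \<Rightarrow> 'a"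
  assumes "finite K"
  obtains U where "U \<subseteq> K" "inj_on f U" "f ` U = K \<inter> f ` K" "card (K - U) = card (K - f ` K)"
proof -
  have "K \<inter> f ` K \<subseteq> f ` K" by blast
  then obtain U where U: "U \<subseteq> K" "inj_on f U" "f ` U = K \<inter> f ` K"
    unfolding subset_image_inj by metis
  have fin: "finite U" using U(1) assms finite_subset by blast
  have "card (K - U) = card K - card U"
    using U(1) fin by (simp add: card_Diff_subset)
  also have "card U = card (K \<inter> f ` K)"
    using U(2,3) card_image by metis
  also have "card K - card (K \<inter> f ` K) = card (K - f ` K)"
    using assms by (simp add: card_Diff_subset_Int)
  finally show ?thesis using U that by blast
qed

lemma sum_translate_diff_le:
  fixes f :: "'a \<Rightarrow> 'a" and G :: "'a \<Rightarrow> real"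
  assumes fin: "finite K" and bound: "\<And>x. \<bar>G x\<bar> \<le> B"
  shows "\<bar>(\<Sum>k\<in>K. G (f k)) - (\<Sum>k\<in>K. G k)\<bar> \<le> 2 * B * card (K - f ` K)"
proof -
  obtain U where U: "U \<subseteq> K" "inj_on f U" "f ` U = K \<inter> f ` K"
    and card: "card (K - U) = card (K - f ` K)"
    using near_injective_subset[OF fin] .
  have 1: "(\<Sum>k\<in>K. G (f k)) = (\<Sum>k\<in>K - U. G (f k)) + (\<Sum>k\<in>U. G (f k))"
    using U(1) fin by (simp add: sum.subset_diff)
  have 2: "(\<Sum>k\<in>K. G k) = (\<Sum>k\<in>K - f ` K. G k) + (\<Sum>k\<in>K \<inter> f ` K. G k)"
    using sum.Int_Diff[OF fin, of G "f ` K"] by simp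
  have 3: "(\<Sum>k\<in>U. G (f k)) = (\<Sum>k\<in>K \<inter> f ` K. G k)"
    unfolding U(3)[symmetric] using U(2) by (simp add: sum.reindex)
  have b: "\<bar>sum g X\<bar> \<le> B * card X" if "\<And>x. \<bar>g x\<bar> \<le> B" for g :: "'a \<Rightarrow> real" and X
    using order_trans[OF sum_abs sum_bounded_above[of X "\<lambda>i. \<bar>g i\<bar>" B]] that
    by (simp add: mult.commute)
  have "\<bar>\<Sum>k\<in>K - U. G (f k)\<bar> \<le> B * card (K - f ` K)"
    using b[of "\<lambda>k. G (f k)" "K - U"] bound card by simp
  moreover have "\<bar>\<Sum>k\<in>K - f ` K. G k\<bar> \<le> B * card (K - f ` K)"
    using b[of G] bound by blast
  ultimately show ?thesis unfolding 1 2 3 by linarith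
qed

text \<open>Left multiplication by \<open>h\<close> is injective on some \<open>U\<close> that omits
  less than a quarter of \<open>K\<close>. For more than half of the \<open>k\<close> in
  \<open>K\<close> the product \<open>x * k\<close> lies in \<open>U\<close>, and likewise for
  \<open>y * k\<close>. Some \<open>k\<close> serves both, and there \<open>h\<close> can be
  cancelled.\<close>

lemma SFC_right_identify:
  fixes h x y :: "'a::semigroup_mult"
  assumes "strong_folner_condition TYPE('a)" and eq: "h * x = h * y"
  obtains r where "x * r = y * r"
proof -
  obtain K where K: "K \<in> finite_nonempty" "folner_invariant {h, x, y} (1/4) K"
    using assms(1) unfolding strong_folner_condition_def
    by (metis finite.emptyI finite.insertI in_finite_nonempty_iff insert_not_empty
        zero_less_divide_1_iff zero_less_numeral)
  then have fin: "finite K" by (simp add: in_finite_nonempty_iff)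
  have small: "card (K - (\<lambda>y. s * y) ` K) < 1/4 * real (card K)" if "s \<in> {h, x, y}" for s
    using K(2) that unfolding folner_invariant_def by blast
  obtain U where U: "U \<subseteq> K" "inj_on ((*) h) U" "card (K - U) = card (K - (*) h ` K)"
    using near_injective_subset[OF fin] by metis
  have finU: "finite U" using U(1) fin finite_subset by blast
  have large: "real (card {k\<in>K. s * k \<in> U}) > card K / 2" if s: "s \<in> {x, y}" for s
  proof -
    \<comment> \<open>A point of \<open>K\<close> that lies in \<open>U\<close> and is hit by
      \<open>s\<close> has the form \<open>s * k\<close> with \<open>k\<close> in the set to be
      estimated. Both exceptional sets are smaller than a quarter of \<open>K\<close>.\<close>
    have "K \<subseteq> (*) s ` {k\<in>K. s * k \<in> U} \<union> (K - U) \<union> (K - (*) s ` K)"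
      using U(1) by auto
    then have "card K \<le> card ((*) s ` {k\<in>K. s * k \<in> U} \<union> (K - U) \<union> (K - (*) s ` K))"
      using fin by (intro card_mono) auto
    also have "\<dots> \<le> card ((*) s ` {k\<in>K. s * k \<in> U}) + card (K - U) + card (K - (*) s ` K)"
      by (meson add_le_mono1 card_Un_le order_trans)
    also have "\<dots> \<le> card {k\<in>K. s * k \<in> U} + card (K - (*) h ` K) + card (K - (*) s ` K)"
      using card_image_le[of "{k\<in>K. s * k \<in> U}" "(*) s"] fin U(3) by simp
    finally have "real (card K) \<le>
        card {k\<in>K. s * k \<in> U} + card (K - (*) h ` K) + card (K - (*) s ` K)"
      by linarith
    then show ?thesis using small[of h] small[of s] s by auto
  qed
  have "{k\<in>K. x * k \<in> U} \<inter> {k\<in>K. y * k \<in> U} \<noteq> {}"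
  proof
    assume "{k\<in>K. x * k \<in> U} \<inter> {k\<in>K. y * k \<in> U} = {}"
    then have "card {k\<in>K. x * k \<in> U} + card {k\<in>K. y * k \<in> U}
        = card ({k\<in>K. x * k \<in> U} \<union> {k\<in>K. y * k \<in> U})"
      using fin by (simp add: card_Un_disjoint)
    also have "\<dots> \<le> card K" using fin by (intro card_mono) auto
    finally show False using large[of x] large[of y] by simp
  qed
  then obtain k where "x * k \<in> U" "y * k \<in> U" by blast
  moreover have "h * (x * k) = h * (y * k)" using eq by (simp add: mult.assoc[symmetric])
  ultimately have "x * k = y * k" using U(2) by (auto dest: inj_onD)
  then show ?thesis using that by blast
qed

text \<open>Induction on \<open>C\<close>: if the new triple violates the implication for no
  \<open>u\<close> because its premise never holds, \<open>s\<close> is kept. Otherwise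
  \<open>SFC_right_identify\<close> supplies \<open>r\<close> such that \<open>s * u * r\<close>
  makes \<open>x\<close> and \<open>y\<close> agree, and so do all its right multiples. The
  quantifier over \<open>u\<close> lets the earlier triples survive the passage from
  \<open>s\<close> to \<open>s * u * r\<close>.\<close>

lemma SFC_injective_translates:
  fixes C :: "('a::semigroup_mult \<times> 'a \<times> 'a) set"
  assumes sfc: "strong_folner_condition TYPE('a)" and "finite C"
  shows "\<exists>s. \<forall>(h, x, y)\<in>C. \<forall>u. h * x * s * u = h * y * s * u \<longrightarrow> x * s * u = y * s * u"
  using assms(2)
proof induction
  case empty
  show ?case by simp
next
  case (insert c C)
  obtain h x y where c: "c = (h, x, y)" by (metis prod.exhaust)
  obtain s where s: "\<forall>(h, x, y)\<in>C. \<forall>u. h * x * s * u = h * y * s * u \<longrightarrow> x * s * u = y * s * u"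
    using insert.IH by blast
  show ?case
  proof (cases "\<exists>u. h * x * s * u = h * y * s * u")
    case False
    then show ?thesis using s c by blast
  next
    case True
    then obtain u where "h * (x * s * u) = h * (y * s * u)" by (auto simp: mult.assoc)
    then obtain r where "x * s * u * r = y * s * u * r"
      using SFC_right_identify[OF sfc] by blast
    then have r: "x * (s * u * r) * v = y * (s * u * r) * v" for v
      by (simp add: mult.assoc[symmetric])
    have "\<forall>(h, x, y)\<in>insert c C. \<forall>v. h * x * (s * u * r) * v = h * y * (s * u * r) * v
        \<longrightarrow> x * (s * u * r) * v = y * (s * u * r) * v"
      using s r c by (auto simp: mult.assoc)
    then show ?thesis by blast
  qed
qed

section \<open>Right translates of finite sets with multiplicities\<close>

text \<open>The layers of the image of \<open>K\<close> under \<open>q\<close> as a multiset.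
  Counting from 0 with a strict inequality puts a point of multiplicity m into exactly the layers 0,
  ..., m - 1.\<close>

definition level_set :: "('a \<Rightarrow> 'b) \<Rightarrow> 'a set \<Rightarrow> nat \<Rightarrow> 'b set" where
  "level_set q K i = {x \<in> q ` K. i < card {k\<in>K. q k = x}}"

lemma card_as_fibre_sum:
  assumes "finite K"
  shows "card {k\<in>K. P k} = (\<Sum>x\<in>q ` K. card {k\<in>K. P k \<and> q k = x})"
proof -
  have "card {k\<in>K. P k} = (\<Sum>k\<in>K. of_bool (P k))"
    using assms by (simp add: Int_def)
  also have "\<dots> = (\<Sum>x\<in>q ` K. \<Sum>k\<in>{k\<in>K. q k = x}. of_bool (P k))"
    by (rule sum.image_gen[OF assms])
  also have "\<dots> = (\<Sum>x\<in>q ` K. card {k\<in>K. P k \<and> q k = x})"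
    using assms by (intro sum.cong) (auto simp: Int_def conj_ac)
  finally show ?thesis .
qed

text \<open>Double counting: a point lies in as many layers as its multiplicity. No fibre is larger
  than \<open>K\<close>, so the layers below \<open>card K\<close> are all that matter.\<close>

lemma sum_card_level_sets:
  assumes fin: "finite K"
  shows "(\<Sum>i<card K. card (A \<inter> level_set q K i)) = card {k\<in>K. q k \<in> A}"
proof -
  have le: "card {k\<in>K. q k = x} \<le> card K" for x
    using fin by (intro card_mono) auto
  have "(\<Sum>i<card K. card (A \<inter> level_set q K i))
      = (\<Sum>i<card K. \<Sum>x\<in>q ` K. of_bool (x \<in> A \<and> i < card {k\<in>K. q k = x}))"
    using fin by (intro sum.cong) (auto simp: level_set_def Int_def conj_ac)
  also have "\<dots> = (\<Sum>x\<in>q ` K. \<Sum>i<card K. of_bool (x \<in> A \<and> i < card {k\<in>K. q k = x}))"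
    by (rule sum.swap)
  also have "\<dots> = (\<Sum>x\<in>q ` K. card {k\<in>K. q k \<in> A \<and> q k = x})"
  proof (intro sum.cong refl)
    fix x
    have "{i. i < card K \<and> i < card {k\<in>K. q k = x}} = {..<card {k\<in>K. q k = x}}"
      using le[of x] by auto
    moreover have "{k\<in>K. q k \<in> A \<and> q k = x} = (if x \<in> A then {k\<in>K. q k = x} else {})"
      by auto
    ultimately show "(\<Sum>i<card K. of_bool (x \<in> A \<and> i < card {k\<in>K. q k = x}))
        = card {k\<in>K. q k \<in> A \<and> q k = x}"
      by (simp add: Int_def)
  qed
  also have "\<dots> = card {k\<in>K. q k \<in> A}"
    by (rule card_as_fibre_sum[OF fin, symmetric])
  finally show ?thesis .
qed

text \<open>Let \<open>w x\<close> be the size of the fibre over \<open>x\<close>, and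
  \<open>c x\<close> the size of its part inside \<open>f\<close>
  K\<open>. The point\<close>x\<open>can be missing from the translate of its layer\<close>i\<open>only if\<close>c
  x \<le> i < w x\<open>. That happens for\<close>w x - c
  x\<open>layers, which is the number of fibre elements outside\<close>f \<open>K\<close>.\<close>

lemma sum_card_level_set_defect_le:
  fixes f :: "'a \<Rightarrow> 'a" and g :: "'b \<Rightarrow> 'b"
  assumes fin: "finite K" and equiv: "\<And>k. q (f k) = g (q k)" and inj: "inj_on g (q ` K)"
  shows "(\<Sum>i<card K. card (level_set q K i - g ` level_set q K i)) \<le> card (K - f ` K)"
proof -
  define c where "c x = card {k \<in> K \<inter> f ` K. q k = x}" for x
  define w where "w x = card {k \<in> K. q k = x}" for x
  have le: "w x \<le> card K" for x
    unfolding w_def using fin by (intro card_mono) auto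
  have sub: "level_set q K i - g ` level_set q K i \<subseteq> {x \<in> q ` K. c x \<le> i \<and> i < w x}" for i
  proof clarify
    fix x assume x: "x \<in> level_set q K i" "x \<notin> g ` level_set q K i"
    have "c x \<le> i"
    proof (rule ccontr)
      assume "\<not> c x \<le> i"
      then have "i < c x" by simp
      then have "{k \<in> K \<inter> f ` K. q k = x} \<noteq> {}" unfolding c_def by (metis card.empty not_less_zero)
      then obtain k where k: "k \<in> K" "q (f k) = x" by auto
      have "{k \<in> K \<inter> f ` K. q k = x} \<subseteq> f ` {k' \<in> K. q k' = q k}"
        using k inj equiv by (auto simp: inj_on_def)
      then have "c x \<le> card (f ` {k' \<in> K. q k' = q k})"
        unfolding c_def using fin by (intro card_mono) auto
      also have "\<dots> \<le> w (q k)" unfolding w_def using fin by (intro card_image_le) auto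
      finally have "q k \<in> level_set q K i"
        using \<open>i < c x\<close> k(1) by (auto simp: level_set_def w_def)
      then show False using x(2) k equiv by auto
    qed
    then show "x \<in> q ` K \<and> c x \<le> i \<and> i < w x"
      using x(1) by (auto simp: level_set_def w_def)
  qed
  have "(\<Sum>i<card K. card (level_set q K i - g ` level_set q K i))
      \<le> (\<Sum>i<card K. card {x \<in> q ` K. c x \<le> i \<and> i < w x})"
    using fin sub by (intro sum_mono card_mono) auto
  also have "\<dots> = (\<Sum>i<card K. \<Sum>x\<in>q ` K. of_bool (c x \<le> i \<and> i < w x))"
    using fin by (intro sum.cong) (auto simp: Int_def)
  also have "\<dots> = (\<Sum>x\<in>q ` K. \<Sum>i<card K. of_bool (c x \<le> i \<and> i < w x))"
    by (rule sum.swap)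
  also have "\<dots> = (\<Sum>x\<in>q ` K. card {k \<in> K. k \<notin> f ` K \<and> q k = x})"
  proof (intro sum.cong refl)
    fix x
    have "{i. i < card K \<and> c x \<le> i \<and> i < w x} = {c x..<w x}"
      using le[of x] by auto
    moreover have "w x - c x = card ({k \<in> K. q k = x} - {k \<in> K \<inter> f ` K. q k = x})"
      unfolding w_def c_def using fin by (subst card_Diff_subset) auto
    moreover have "{k \<in> K. q k = x} - {k \<in> K \<inter> f ` K. q k = x} = {k \<in> K. k \<notin> f ` K \<and> q k = x}"
      by auto
    ultimately show "(\<Sum>i<card K. of_bool (c x \<le> i \<and> i < w x))
        = card {k \<in> K. k \<notin> f ` K \<and> q k = x}"
      by (simp add: Int_def)
  qed
  also have "\<dots> = card {k \<in> K. k \<notin> f ` K}"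
    by (rule card_as_fibre_sum[OF fin, symmetric])
  also have "{k \<in> K. k \<notin> f ` K} = K - f ` K" by auto
  finally show ?thesis .
qed

section \<open>Means\<close>

lemma apply_bcontfun_sum:
  fixes g :: "'i \<Rightarrow> 'a::topological_space \<Rightarrow>\<^sub>C 'b::real_normed_vector"
  shows "apply_bcontfun (\<Sum>i\<in>I. g i) x = (\<Sum>i\<in>I. apply_bcontfun (g i) x)"
  by (induction I rule: infinite_finite_induct) auto

lemma norm_char_fun_le: "norm (char_fun A) \<le> 1"
  by (rule norm_bound) (auto simp: indicator_def)

lemma mean_mono:
  assumes "is_mean \<mu>" "\<And>x. apply_bcontfun f x \<le> apply_bcontfun g x"
  shows "blinfun_apply \<mu> f \<le> blinfun_apply \<mu> g"
proof -
  have "0 \<le> blinfun_apply \<mu> (g - f)"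
    using assms unfolding is_mean_def by simp
  then show ?thesis by (simp add: blinfun.diff_right)
qed

text \<open>Means are normalized through their norm; positivity turns this into the value at the
  constant 1. Bounding \<open>f\<close> between multiples of that constant gives
  \<open>norm \<mu> \<le> blinfun_apply \<mu> (char_fun UNIV)\<close>.\<close>

lemma mean_UNIV:
  assumes "is_mean \<mu>"
  shows "blinfun_apply \<mu> (char_fun UNIV) = 1"
proof (rule antisym)
  have n: "norm \<mu> = 1" using assms by (simp add: is_mean_def)
  have "norm (blinfun_apply \<mu> (char_fun UNIV)) \<le> 1 * norm (char_fun (UNIV :: 'a set))"
    using norm_blinfun[of \<mu> "char_fun UNIV"] n by simp
  then show "blinfun_apply \<mu> (char_fun UNIV) \<le> 1"
    using norm_char_fun_le[of "UNIV :: 'a set"] by simp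
  have pos: "0 \<le> blinfun_apply \<mu> (char_fun UNIV)"
    using assms unfolding is_mean_def by simp
  have "norm (blinfun_apply \<mu> f) \<le> blinfun_apply \<mu> (char_fun UNIV) * norm f" for f
  proof -
    have b: "\<bar>apply_bcontfun f x\<bar> \<le> norm f" for x
      using norm_bounded[of f x] by simp
    have "blinfun_apply \<mu> f \<le> blinfun_apply \<mu> (norm f *\<^sub>R char_fun UNIV)"
      by (rule mean_mono[OF assms]) (use b in \<open>simp add: abs_le_iff\<close>)
    moreover have "blinfun_apply \<mu> (- norm f *\<^sub>R char_fun UNIV) \<le> blinfun_apply \<mu> f"
      by (rule mean_mono[OF assms]) (use b in \<open>simp add: abs_le_iff minus_le_iff\<close>)
    ultimately show ?thesis by (simp add: blinfun.scaleR_right blinfun.minus_right mult.commute)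
  qed
  then have "norm \<mu> \<le> blinfun_apply \<mu> (char_fun UNIV)"
    using norm_blinfun_bound[OF pos] by blast
  then show "1 \<le> blinfun_apply \<mu> (char_fun UNIV)" using n by simp
qed

lemma mean_char_fun_bounds:
  assumes "is_mean \<mu>"
  shows "blinfun_apply \<mu> (char_fun A) \<in> {0..1}"
  using mean_mono[OF assms, of "char_fun A" "char_fun UNIV"] mean_UNIV[OF assms] assms
  by (auto simp: is_mean_def)

lemma mean_le_value:
  assumes mean: "is_mean \<mu>" and fin: "finite (range (apply_bcontfun g))"
  obtains x where "blinfun_apply \<mu> g \<le> apply_bcontfun g x"
proof -
  obtain x where x: "apply_bcontfun g x = Max (range (apply_bcontfun g))"
    using Max_in[OF fin] by force
  have "blinfun_apply \<mu> g \<le> blinfun_apply \<mu> (apply_bcontfun g x *\<^sub>R char_fun UNIV)"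
    by (rule mean_mono[OF mean]) (simp add: x fin)
  also have "\<dots> = apply_bcontfun g x"
    by (simp add: blinfun.scaleR_right mean_UNIV[OF mean])
  finally show ?thesis using that by blast
qed

text \<open>An indexed family \<open>e\<close>, rather than a set, lets coinciding translates be
  counted with multiplicity.\<close>

lemma LIM_good_translate:
  fixes A :: "'a::semigroup_mult set" and e :: "'i \<Rightarrow> 'a"
  assumes \<mu>: "\<mu> \<in> LIM_set" and fin: "finite I"
  obtains s where "blinfun_apply \<mu> (char_fun A) * card I \<le> card {i\<in>I. e i * s \<in> A}"
proof -
  define g where "g = (\<Sum>i\<in>I. left_translate (e i) (char_fun A))"
  have mean: "is_mean \<mu>" using \<mu> by (simp add: LIM_set_def)
  have g: "apply_bcontfun g x = card {i\<in>I. e i * of_discrete x \<in> A}" for x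
    unfolding g_def apply_bcontfun_sum
    using fin by (simp add: discrete_inverse indicator_def sum.If_cases Int_def of_bool_def)
  have "range (apply_bcontfun g) \<subseteq> real ` {..card I}"
    using fin by (auto simp: g intro!: card_mono)
  then have "finite (range (apply_bcontfun g))" by (rule finite_subset) simp
  then obtain x where "blinfun_apply \<mu> g \<le> apply_bcontfun g x"
    using mean_le_value[OF mean] by blast
  moreover have "blinfun_apply \<mu> g = blinfun_apply \<mu> (char_fun A) * card I"
    using \<mu> by (simp add: g_def blinfun.sum_right LIM_set_def)
  ultimately show ?thesis using that g by metis
qed

section \<open>Left invariant means by compactness\<close>

text \<open>As in the Banach-Alaoglu theorem, the functionals in question form a closed subset
  \<open>M\<close> of a compact product of intervals. Approximate invariance under one element is a
  closed condition \<open>C (h, \<epsilon>)\<close>, and by hypothesis finitely many of these can be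
  met at once within \<open>M\<close>. A point common to all of them is exactly invariant.\<close>

lemma LIM_of_approximately_invariant:
  fixes A :: "'a::semigroup_mult set" and \<alpha> :: real
  assumes approx: "\<And>H \<epsilon>. finite H \<Longrightarrow> H \<noteq> {} \<Longrightarrow> \<epsilon> > 0 \<Longrightarrow> \<exists>L :: 'a l_infinity \<Rightarrow> real.
      linear L \<and> (\<forall>g. \<bar>L g\<bar> \<le> norm g) \<and> (\<forall>g. (\<forall>x. 0 \<le> apply_bcontfun g x) \<longrightarrow> 0 \<le> L g) \<and>
      L (char_fun UNIV) = 1 \<and> \<alpha> \<le> L (char_fun A) \<and>
      (\<forall>h\<in>H. \<forall>g. \<bar>L (left_translate h g) - L g\<bar> \<le> \<epsilon> * norm g)"
  obtains \<mu> where "\<mu> \<in> LIM_set" "\<alpha> \<le> blinfun_apply \<mu> (char_fun A)"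
proof -
  define M where "M = {L :: 'a l_infinity \<Rightarrow> real.
      linear L \<and> (\<forall>g. \<bar>L g\<bar> \<le> norm g) \<and> (\<forall>g. (\<forall>x. 0 \<le> apply_bcontfun g x) \<longrightarrow> 0 \<le> L g) \<and>
      L (char_fun UNIV) = 1 \<and> \<alpha> \<le> L (char_fun A)}"
  define C where "C = (\<lambda>(h :: 'a, \<epsilon>). {L. \<forall>g. \<bar>L (left_translate h g) - L g\<bar> \<le> \<epsilon> * norm g})"
  have ev: "continuous_on UNIV (\<lambda>L :: 'a l_infinity \<Rightarrow> real. L g)" for g
    by (rule continuous_on_product_coordinates)
  have "compact (\<Pi>\<^sub>E g\<in>UNIV. {- norm g..norm g} :: ('a l_infinity \<Rightarrow> real) set)"
    using compactin_PiE[of "\<lambda>_. euclideanreal" UNIV "\<lambda>g :: 'a l_infinity. {- norm g..norm g}"]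
    by (simp add: euclidean_product_topology)
  moreover have "closed M"
    unfolding M_def linear_iff
    by (intro closed_Collect_conj closed_Collect_all closed_Collect_imp closed_Collect_le
        closed_Collect_eq continuous_intros ev) auto
  moreover have "M \<subseteq> (\<Pi>\<^sub>E g\<in>UNIV. {- norm g..norm g})"
    by (auto simp: M_def abs_le_iff minus_le_iff)
  ultimately have "compact M"
    by (metis compact_Int_closed inf.absorb2)
  moreover have "closed (C p)" for p
    unfolding C_def case_prod_beta
    by (intro closed_Collect_all closed_Collect_le continuous_intros ev)
  moreover have "M \<inter> (\<Inter>p\<in>I'. C p) \<noteq> {}" if I': "finite I'" "I' \<subseteq> UNIV \<times> {0<..}" for I'
  proof -
    \<comment> \<open>The 1 keeps the minimum defined for empty \<open>I'\<close>;
      \<open>undefined\<close> below likewise provides the nonempty \<open>H\<close> that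
      \<open>approx\<close> demands.\<close>
    define \<epsilon> where "\<epsilon> = Min (insert 1 (snd ` I'))"
    have "\<epsilon> > 0" unfolding \<epsilon>_def using I' by auto
    then obtain L where L: "L \<in> M"
      "\<forall>h\<in>insert undefined (fst ` I'). \<forall>g. \<bar>L (left_translate h g) - L g\<bar> \<le> \<epsilon> * norm g"
      using approx[of "insert undefined (fst ` I')" \<epsilon>] I'(1) unfolding M_def by auto
    have "L \<in> C p" if p: "p \<in> I'" for p
    proof -
      obtain h \<delta> where hd: "p = (h, \<delta>)" by (metis prod.exhaust)
      have "\<epsilon> \<le> \<delta>" unfolding \<epsilon>_def using p I'(1) hd by (intro Min_le) force+
      moreover have "h \<in> fst ` I'" using p hd by force
      ultimately have "\<bar>L (left_translate h g) - L g\<bar> \<le> \<delta> * norm g" for g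
        using L(2) by (meson insertI2 mult_right_mono norm_ge_zero order_trans)
      then show ?thesis unfolding C_def hd by simp
    qed
    then show ?thesis using L(1) by blast
  qed
  ultimately have "M \<inter> (\<Inter>p\<in>UNIV \<times> {0<..}. C p) \<noteq> {}"
    by (rule compact_imp_fip_image)
  then obtain L where L: "L \<in> M" "\<And>h \<epsilon>. \<epsilon> > 0 \<Longrightarrow> L \<in> C (h, \<epsilon>)" by auto
  have inv: "L (left_translate h g) = L g" for h g
  proof -
    have "\<bar>L (left_translate h g) - L g\<bar> \<le> \<epsilon>" if "\<epsilon> > 0" for \<epsilon>
    proof -
      \<comment> \<open>Adding 1 keeps the divisor positive when \<open>g\<close> is zero.\<close>
      have "\<bar>L (left_translate h g) - L g\<bar> \<le> \<epsilon> / (norm g + 1) * norm g"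
        using L(2)[of "\<epsilon> / (norm g + 1)" h] that unfolding C_def
        by (simp add: add_nonneg_pos)
      also have "\<dots> \<le> \<epsilon>" using that by (simp add: field_simps add_pos_nonneg)
      finally show ?thesis .
    qed
    then show ?thesis
      using field_le_epsilon[of "\<bar>L (left_translate h g) - L g\<bar>" 0] by simp
  qed
  have lin: "linear L" and le: "\<And>g. \<bar>L g\<bar> \<le> norm g" and one: "L (char_fun UNIV) = 1"
    using L(1) by (auto simp: M_def)
  have "bounded_linear L"
    using lin le by (intro bounded_linear_intro[of L 1]) (auto simp: linear_iff)
  then have ap: "blinfun_apply (Blinfun L) = L" by (rule bounded_linear_Blinfun_apply)
  have "norm (Blinfun L) = 1"
  proof (rule antisym)
    show "norm (Blinfun L) \<le> 1" by (rule norm_blinfun_bound) (auto simp: ap le)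
    have "1 \<le> norm (Blinfun L) * norm (char_fun (UNIV :: 'a set))"
      using norm_blinfun[of "Blinfun L" "char_fun UNIV"] by (simp add: ap one)
    also have "\<dots> \<le> norm (Blinfun L)"
      using mult_left_mono[OF norm_char_fun_le[of "UNIV :: 'a set"], of "norm (Blinfun L)"] by simp
    finally show "1 \<le> norm (Blinfun L)" .
  qed
  then have "Blinfun L \<in> LIM_set"
    using L(1) inv by (auto simp: LIM_set_def is_mean_def ap M_def)
  moreover have "\<alpha> \<le> blinfun_apply (Blinfun L) (char_fun A)"
    using L(1) by (simp add: ap M_def)
  ultimately show ?thesis using that by blast
qed

text \<open>
  The map \<open>p\<close> stands for a right translation or the identity, as the semigroup may lack a unit.
\<close>

lemma LIM_of_translated_folner_sets:
  fixes A :: "'a::semigroup_mult set" and \<alpha> :: real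
  assumes sets: "\<And>H \<epsilon>. H \<in> finite_nonempty \<Longrightarrow> \<epsilon> > 0 \<Longrightarrow> \<exists>K p. K \<in> finite_nonempty \<and>
      folner_invariant H \<epsilon> K \<and> (\<forall>x y. p (x * y) = x * p y) \<and>
      \<alpha> * card K \<le> card {k\<in>K. p k \<in> A}"
  obtains \<mu> where "\<mu> \<in> LIM_set" "\<alpha> \<le> blinfun_apply \<mu> (char_fun A)"
proof (rule LIM_of_approximately_invariant[of \<alpha> A])
  fix H :: "'a set" and \<epsilon> :: real
  assume H: "finite H" "H \<noteq> {}" and eps: "\<epsilon> > 0"
  \<comment> \<open>Halving \<epsilon> absorbs the factor 2 of
    \<open>sum_translate_diff_le\<close>.\<close>
  then obtain K p where K: "K \<in> finite_nonempty" "folner_invariant H (\<epsilon>/2) K"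
    and p: "\<And>x y. p (x * y) = x * p y" and \<alpha>: "\<alpha> * card K \<le> card {k\<in>K. p k \<in> A}"
    using sets[of H "\<epsilon>/2"] by (auto simp: in_finite_nonempty_iff)
  have fin: "finite K" and pos: "real (card K) > 0"
    using K(1) by (auto simp: in_finite_nonempty_iff card_gt_0_iff)
  define L where
    "L g = (\<Sum>k\<in>K. apply_bcontfun g (discrete (p k))) / card K" for g :: "'a l_infinity"
  have b: "\<bar>apply_bcontfun g x\<bar> \<le> norm g" for g :: "'a l_infinity" and x
    using norm_bounded[of g x] by simp
  have "linear L"
    unfolding L_def by (rule linearI)
      (simp_all add: sum.distrib add_divide_distrib sum_distrib_left[symmetric])
  moreover have "\<bar>L g\<bar> \<le> norm g" for g
  proof -
    have "\<bar>\<Sum>k\<in>K. apply_bcontfun g (discrete (p k))\<bar> \<le> (\<Sum>k\<in>K. norm g)"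
      by (rule order_trans[OF sum_abs sum_mono]) (rule b)
    then show ?thesis using pos by (simp add: L_def abs_divide field_simps)
  qed
  moreover have "0 \<le> L g" if "\<forall>x. 0 \<le> apply_bcontfun g x" for g
    unfolding L_def using that by (intro divide_nonneg_nonneg sum_nonneg) auto
  moreover have "L (char_fun UNIV) = 1" using pos by (simp add: L_def)
  moreover have "\<alpha> \<le> L (char_fun A)"
    using \<alpha> pos fin
    by (simp add: L_def discrete_inverse indicator_def sum.If_cases Int_def of_bool_def field_simps)
  moreover have "\<bar>L (left_translate h g) - L g\<bar> \<le> \<epsilon> * norm g" if h: "h \<in> H" for h g
  proof -
    have "\<bar>(\<Sum>k\<in>K. apply_bcontfun g (discrete (p (h * k)))) - (\<Sum>k\<in>K. apply_bcontfun g (discrete (p k)))\<bar>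
        \<le> 2 * norm g * card (K - (*) h ` K)"
      using sum_translate_diff_le[OF fin, of "\<lambda>k. apply_bcontfun g (discrete (p k))" "norm g" "(*) h"] b
      by blast
    also have "\<dots> \<le> 2 * norm g * (\<epsilon>/2 * card K)"
      using K(2) h unfolding folner_invariant_def by (intro mult_left_mono) (blast intro: less_imp_le, simp)
    also have "\<dots> = \<epsilon> * norm g * card K" by simp
    finally show ?thesis
      using pos by (simp add: L_def p discrete_inverse pos_divide_le_eq flip: diff_divide_distrib)
  qed
  ultimately show "\<exists>L :: 'a l_infinity \<Rightarrow> real.
      linear L \<and> (\<forall>g. \<bar>L g\<bar> \<le> norm g) \<and> (\<forall>g. (\<forall>x. 0 \<le> apply_bcontfun g x) \<longrightarrow> 0 \<le> L g) \<and>
      L (char_fun UNIV) = 1 \<and> \<alpha> \<le> L (char_fun A) \<and>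
      (\<forall>h\<in>H. \<forall>g. \<bar>L (left_translate h g) - L g\<bar> \<le> \<epsilon> * norm g)"
    by blast
qed (use that in blast)

section \<open>Folner sets of prescribed density from a left invariant mean\<close>

text \<open>The gap between \<alpha> and the mean of \<open>A\<close> pays for the invariance
  defects of the level sets. Averaging then yields one level set that is both almost invariant and
  dense in \<open>A\<close>.\<close>

lemma LIM_density_folner_sets:
  fixes A :: "'a::semigroup_mult set"
  assumes sfc: "strong_folner_condition TYPE('a)" and \<mu>: "\<mu> \<in> LIM_set"
    and H: "H \<in> finite_nonempty" and eps: "\<epsilon> > 0"
    and \<alpha>: "0 \<le> \<alpha>" "\<alpha> < blinfun_apply \<mu> (char_fun A)"
  shows "\<exists>K\<in>finite_nonempty. folner_invariant H \<epsilon> K \<and> \<alpha> * card K \<le> card (A \<inter> K)"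
proof -
  define \<beta> where "\<beta> = blinfun_apply \<mu> (char_fun A)"
  \<comment> \<open>With this choice the defects of the level sets, weighted by \<open>1 / \<epsilon>\<close> and summed over \<open>H\<close>,
    stay below \<open>(\<beta> - \<alpha>) |K|\<close>.\<close>
  define \<eta> where "\<eta> = (\<beta> - \<alpha>) * \<epsilon> / card H"
  have finH: "finite H" and cH: "real (card H) > 0"
    using H by (auto simp: in_finite_nonempty_iff card_gt_0_iff)
  have "\<eta> > 0" using cH eps \<alpha> by (simp add: \<eta>_def \<beta>_def)
  then obtain K where K: "K \<in> finite_nonempty" "folner_invariant H \<eta> K"
    using sfc H unfolding strong_folner_condition_def by blast
  have finK: "finite K" using K(1) by (simp add: in_finite_nonempty_iff)
  obtain s\<^sub>0 where s\<^sub>0: "\<forall>(h, x, y)\<in>H \<times> K \<times> K. \<forall>u. h * x * s\<^sub>0 * u = h * y * s\<^sub>0 * u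
      \<longrightarrow> x * s\<^sub>0 * u = y * s\<^sub>0 * u"
    using SFC_injective_translates[OF sfc, of "H \<times> K \<times> K"] finH finK by blast
  \<comment> \<open>The property of \<open>s\<^sub>0\<close> holds for every \<open>u\<close>, so
    \<open>u\<close> may still be chosen to give the translate its density in
    \<open>A\<close>.\<close>
  obtain u where u: "\<beta> * card K \<le> card {k\<in>K. k * s\<^sub>0 * u \<in> A}"
    using LIM_good_translate[OF \<mu> finK, where e = "\<lambda>k. k * s\<^sub>0"] unfolding \<beta>_def by blast
  define q where "q k = k * s\<^sub>0 * u" for k
  define N where "N = level_set q K"
  have finN: "finite (N i)" for i unfolding N_def level_set_def using finK by simp
  have inj: "inj_on ((*) h) (q ` K)" if "h \<in> H" for h
    using s\<^sub>0 that by (fastforce simp: inj_on_def q_def mult.assoc)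
  have defect: "(\<Sum>i<card K. real (card (N i - (*) h ` N i))) < \<eta> * card K" if h: "h \<in> H" for h
  proof -
    have "(\<Sum>i<card K. card (N i - (*) h ` N i)) \<le> card (K - (*) h ` K)"
      unfolding N_def
      by (rule sum_card_level_set_defect_le[OF finK _ inj[OF h]]) (simp add: q_def mult.assoc)
    then have "(\<Sum>i<card K. real (card (N i - (*) h ` N i))) \<le> card (K - (*) h ` K)"
      by (simp flip: of_nat_sum)
    also have "\<dots> < \<eta> * card K" using K(2) h unfolding folner_invariant_def by blast
    finally show ?thesis .
  qed
  define D where "D i = (\<Sum>h\<in>H. real (card (N i - (*) h ` N i)))" for i
  have "(\<Sum>i<card K. D i) = (\<Sum>h\<in>H. \<Sum>i<card K. real (card (N i - (*) h ` N i)))"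
    unfolding D_def by (rule sum.swap)
  also have "\<dots> < (\<Sum>h\<in>H. \<eta> * card K)"
    using H finH defect by (intro sum_strict_mono) (auto simp: in_finite_nonempty_iff)
  also have "\<dots> = (\<beta> - \<alpha>) * \<epsilon> * card K" using cH by (simp add: \<eta>_def)
  finally have Dsum: "(\<Sum>i<card K. D i / \<epsilon>) < (\<beta> - \<alpha>) * card K"
    using eps by (simp add: sum_divide_distrib[symmetric] field_simps)
  have "(\<Sum>i<card K. real (card (A \<inter> N i))) = card {k\<in>K. q k \<in> A}"
    using sum_card_level_sets[OF finK, of A q] by (simp add: N_def flip: of_nat_sum)
  then have Asum: "\<beta> * card K \<le> (\<Sum>i<card K. real (card (A \<inter> N i)))"
    using u by (simp add: q_def)
  have "(\<Sum>i<card K. real (card (N i))) = card K"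
    using sum_card_level_sets[OF finK, of UNIV q] by (simp add: N_def flip: of_nat_sum)
  then have "(\<Sum>i<card K. \<alpha> * card (N i)) = \<alpha> * card K"
    by (simp flip: sum_distrib_left)
  \<comment> \<open>One strict inequality at some \<open>i\<close> gives everything: dropping the
    \<alpha> term gives invariance, dropping the defect gives density, and strictness makes
    \<open>N i\<close> nonempty.\<close>
  then have "(\<Sum>i<card K. \<alpha> * card (N i) + D i / \<epsilon>) < (\<Sum>i<card K. real (card (A \<inter> N i)))"
    using Dsum Asum by (simp add: sum.distrib algebra_simps)
  then obtain i where i: "\<alpha> * card (N i) + D i / \<epsilon> < card (A \<inter> N i)"
    by (meson not_le sum_mono)
  have Dnn: "0 \<le> D i / \<epsilon>" unfolding D_def using eps by (simp add: sum_nonneg)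
  have le: "card (A \<inter> N i) \<le> card (N i)" using finN by (intro card_mono) auto
  have "folner_invariant H \<epsilon> (N i)"
    unfolding folner_invariant_def
  proof
    fix h assume h: "h \<in> H"
    have "real (card (N i - (*) h ` N i)) \<le> D i"
      unfolding D_def using h finH
      by (intro member_le_sum[of h H "\<lambda>h. real (card (N i - (*) h ` N i))"]) auto
    also have "D i / \<epsilon> < card (N i)"
    proof -
      have "0 \<le> \<alpha> * card (N i)" using \<alpha>(1) by simp
      then show ?thesis using i le by linarith
    qed
    then have "D i < \<epsilon> * card (N i)" using eps by (simp add: field_simps)
    finally show "real (card (N i - (*) h ` N i)) < \<epsilon> * card (N i)" .
  qed
  moreover have "\<alpha> * card (N i) \<le> card (A \<inter> N i)"
    using i Dnn by linarith
  moreover have "N i \<in> finite_nonempty"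
    using i finN Dnn by (auto simp: in_finite_nonempty_iff)
  ultimately show ?thesis by blast
qed

section \<open>Comparison of the three densities\<close>

theorem theorem3p15:
  fixes A :: "'a::semigroup_mult set"
  assumes "strong_folner_condition TYPE('a)"
  shows "folner_density A = banach_density A \<and> banach_density A = translation_density A"
proof -
  define D where "D = {\<alpha> :: real. \<alpha> \<in> {0..1} \<and> (\<forall>H \<in> finite_nonempty. \<forall>\<epsilon>>0. \<exists>K \<in> finite_nonempty.
       folner_invariant H \<epsilon> K \<and> real (card (A \<inter> K)) \<ge> \<alpha> * real (card K))}"
  define T where "T = {\<alpha> :: real. \<alpha> \<in> {0..1} \<and> (\<forall>F \<in> finite_nonempty. \<exists>s.
       real (card (F \<inter> right_quotient A s)) \<ge> \<alpha> * real (card F))}"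
  define B where "B = {blinfun_apply \<mu> (char_fun A) | \<mu>. \<mu> \<in> LIM_set}"
  have D_LIM: "\<exists>\<beta>\<in>B. \<alpha> \<le> \<beta>" if "\<alpha> \<in> D" for \<alpha>
  proof -
    have "\<exists>K p. K \<in> finite_nonempty \<and> folner_invariant H \<epsilon> K \<and> (\<forall>x y. p (x * y) = x * p y) \<and>
        \<alpha> * card K \<le> card {k\<in>K. p k \<in> A}" 
      if H: "H \<in> finite_nonempty" "\<epsilon> > 0" for H :: "'a set" and \<epsilon> :: real
    proof -
      obtain K where "K \<in> finite_nonempty" "folner_invariant H \<epsilon> K" "card (A \<inter> K) \<ge> \<alpha> * card K"
        using \<open>\<alpha> \<in> D\<close> H unfolding D_def by blast
      moreover have "A \<inter> K = {k\<in>K. k \<in> A}" by auto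
      ultimately show ?thesis by (intro exI[of _ K] exI[of _ "\<lambda>k. k"]) simp
    qed
    then obtain \<mu> where "\<mu> \<in> LIM_set" "\<alpha> \<le> blinfun_apply \<mu> (char_fun A)"
      using LIM_of_translated_folner_sets[of \<alpha> A] by blast
    then show ?thesis by (auto simp: B_def)
  qed
  have T_LIM: "\<exists>\<beta>\<in>B. \<alpha> \<le> \<beta>" if "\<alpha> \<in> T" for \<alpha>
  proof -
    have "\<exists>K p. K \<in> finite_nonempty \<and> folner_invariant H \<epsilon> K \<and> (\<forall>x y. p (x * y) = x * p y) \<and>
        \<alpha> * card K \<le> card {k\<in>K. p k \<in> A}" 
      if H: "H \<in> finite_nonempty" "\<epsilon> > 0" for H :: "'a set" and \<epsilon> :: real
    proof -
      obtain K where K: "K \<in> finite_nonempty" "folner_invariant H \<epsilon> K"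
        using assms H unfolding strong_folner_condition_def by blast
      \<comment> \<open>Testing the translation density on an almost invariant \<open>K\<close>
        provides a right translate of a Folner set that is dense in \<open>A\<close>.\<close>
      then obtain s where "card (K \<inter> right_quotient A s) \<ge> \<alpha> * card K"
        using \<open>\<alpha> \<in> T\<close> unfolding T_def by blast
      moreover have "K \<inter> right_quotient A s = {k\<in>K. k * s \<in> A}"
        by (auto simp: right_quotient_def)
      ultimately show ?thesis
        using K by (intro exI[of _ K] exI[of _ "\<lambda>k. k * s"]) (simp add: mult.assoc)
    qed
    then obtain \<mu> where "\<mu> \<in> LIM_set" "\<alpha> \<le> blinfun_apply \<mu> (char_fun A)"
      using LIM_of_translated_folner_sets[of \<alpha> A] by blast
    then show ?thesis by (auto simp: B_def)
  qed
  have LIM_T: "\<beta> \<in> T" if \<beta>: "\<beta> \<in> B" for \<beta>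
  proof -
    obtain \<mu> where \<mu>: "\<mu> \<in> LIM_set" "\<beta> = blinfun_apply \<mu> (char_fun A)"
      using \<beta> by (auto simp: B_def)
    have "\<beta> \<in> {0..1}" using \<mu> mean_char_fun_bounds by (auto simp: LIM_set_def)
    moreover have "\<exists>s. card (F \<inter> right_quotient A s) \<ge> \<beta> * card F" if F: "F \<in> finite_nonempty" for F
    proof -
      obtain s where "\<beta> * card F \<le> card {k\<in>F. k * s \<in> A}"
        using LIM_good_translate[OF \<mu>(1), of F A "\<lambda>k. k"] \<mu>(2) F
        by (auto simp: in_finite_nonempty_iff)
      moreover have "F \<inter> right_quotient A s = {k\<in>F. k * s \<in> A}"
        by (auto simp: right_quotient_def)
      ultimately show ?thesis by metis
    qed
    ultimately show ?thesis by (simp add: T_def)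
  qed
  have LIM_D: "\<alpha> \<in> D" if \<beta>: "\<beta> \<in> B" and \<alpha>: "0 \<le> \<alpha>" "\<alpha> < \<beta>" for \<alpha> \<beta>
  proof -
    obtain \<mu> where \<mu>: "\<mu> \<in> LIM_set" "\<beta> = blinfun_apply \<mu> (char_fun A)"
      using \<beta> by (auto simp: B_def)
    have "\<alpha> \<le> 1" using \<alpha> LIM_T[OF \<beta>] by (simp add: T_def)
    then show ?thesis
      using LIM_density_folner_sets[OF assms \<mu>(1)] \<alpha> \<mu>(2) by (simp add: D_def)
  qed
  \<comment> \<open>With \<open>D_LIM\<close> this yields a left invariant mean, so that
    \<open>B\<close> is nonempty.\<close>
  have D0: "0 \<in> D"
    using assms unfolding D_def strong_folner_condition_def by simp
  then obtain \<beta>\<^sub>0 where B0: "\<beta>\<^sub>0 \<in> B" using D_LIM by blast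
  have bdd: "bdd_above D" "bdd_above T" by (auto simp: D_def T_def intro!: bdd_aboveI[of _ 1])
  have "B \<subseteq> T" using LIM_T by blast
  then have bddB: "bdd_above B" by (rule bdd_above_mono[OF bdd(2)])
  have "Sup D = Sup B"
  proof (rule antisym)
    show "Sup D \<le> Sup B" using D0 D_LIM bddB by (intro cSup_mono) auto
    show "Sup B \<le> Sup D"
    proof (rule cSup_least)
      fix \<beta> assume \<beta>: "\<beta> \<in> B"
      then have "0 \<le> \<beta>" using LIM_T by (force simp: T_def)
      show "\<beta> \<le> Sup D"
      \<comment> \<open>\<open>LIM_D\<close> reaches only values strictly below
        \<open>\<beta>\<close>, so the bound is obtained in the limit. The maximum with 0 is needed
        because members of \<open>D\<close> are nonnegative.\<close>
      proof (rule dense_le)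
        fix \<alpha> assume "\<alpha> < \<beta>"
        then have "max 0 \<alpha> \<in> D"
          using LIM_D[OF \<beta>] D0 by (cases "0 \<le> \<alpha>") (auto simp: max_def)
        then show "\<alpha> \<le> Sup D" using cSup_upper[OF _ bdd(1)] by fastforce
      qed
    qed (use B0 in blast)
  qed
  moreover have "Sup B = Sup T"
  proof (rule antisym)
    show "Sup B \<le> Sup T" using B0 bdd(2) \<open>B \<subseteq> T\<close> by (intro cSup_subset_mono) auto
    show "Sup T \<le> Sup B" using B0 \<open>B \<subseteq> T\<close> T_LIM bddB by (intro cSup_mono) auto
  qed
  ultimately show ?thesis
    unfolding folner_density_def banach_density_def translation_density_def D_def T_def B_def
    by simp
qed

end
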